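(* Let $k$ be a field and let $\mathrm{MLb}(X)$ be the free metabelian Leibniz algebra over $k$ generated by a well-ordered set $X$ (all generators of degree $1$). Then the set $$\{[c_1\cdots c_pa_1a_2]_L-[c_1\cdots c_pa_2a_1]_L\mid c_1,\dots,c_p,a_1,a_2\in X,\ p\ge2,\ a_2<a_1\}$$ is a Gröbner–Shirshov basis in the free Leibniz algebra $\mathrm{Lb}(X)$, and the following set is a linear basis of $\mathrm{MLb}(X)$: $$\{[a_1a_2\cdots a_n]_L\mid a_1,\dots,a_n\in X,\ n\ge1,\ a_3\le a_4\le\cdots\le a_n\}.$$
   Context: A Leibniz algebra over $k$ is a vector space with bilinear product $(xy)$ satisfying $(x(yz))=((xy)z)-((xz)y)$. It is abelian if all products are zero, and metabelian if it is an extension of an abelian Leibniz algebra by another abelian one (equivalently, all products $((xy)(zw))$ vanish). $\mathrm{Lb}(X)$ and $\mathrm{MLb}(X)$ are the free Leibniz algebra and the free metabelian Leibniz algebra on $X$. $[f_1\cdots f_n]_L:=((\cdots((f_1f_2)f_3)\cdots)f_n)$. $\mathrm{NF}(X)=\{[a_1\cdots a_n]_L\mid a_i\in X,\ n\ge 1\}$ is a linear basis of $\mathrm{Lb}(X)$; $\ell([a_1\cdots a_n]_L)=\deg([a_1\cdots a_n]_L)=n$. Order: $\mu<\nu$ in $\mathrm{NF}(X)$ iff $(\deg\mu,\ell(\mu),a_1,\dots,a_n)<(\deg\nu,\ell(\nu),b_1,\dots,b_m)$ lexicographically, where $\mu=[a_1\cdots a_n]_L$, $\nu=[b_1\cdots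 b_m]_L$. $\overline f$ is the leading (largest) monomial of $f\neq0$; $f$ is monic if $\overline f$ has coefficient $1$. Gröbner–Shirshov bases. Let $S\subseteq\mathrm{Lb}(X)$ be a set of monic elements, $s\in S$, $a_1,\dots,a_m\in X$, $m\ge0$. Normal $S$-polynomials are (1) $[sa_1\cdots a_m]_L$, and (2) $[a_1\cdots a_tsa_{t+1}\cdots a_m]_L$ if $\ell(\overline s)=1$, $1\le t\le m$; notation $h_s$. An element is trivial modulo $(S,\mu)$ (resp. $(S,n)$) if it is a linear combination of normal $S$-polynomials with leading monomials $<\mu$ (resp. of degree $\le n$). $S$ is a Gröbner–Shirshov basis in $\mathrm{Lb}(X)$ if: for all $f\neq g$ in $S$ with $\overline f=\overline{h_g}$ for a normal $S$-polynomial $h_g$, $f-h_g$ is trivial modulo $(S,\overline f)$; and for all $f\in S$ with $\ell(\overline f)>1$ and $\mu\in\mathrm{NF}(X)$ with $(\mu f)\neq0$, $(\mu f)$ is trivial modulo $(S,\deg\mu+\deg\overline f)$. *)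

theory Defs
  imports Complex_Main
begin

section \<open>Leibniz algebras\<close>

locale leibniz_algebra = vector_space scale
  for scale :: "'k::field \<Rightarrow> 'v::ab_group_add \<Rightarrow> 'v" +
  fixes mult :: "'v \<Rightarrow> 'v \<Rightarrow> 'v"
  assumes mult_add_left: "mult (x + y) z = mult x z + mult y z"
    and mult_add_right: "mult x (y + z) = mult x y + mult x z"
    and mult_scale_left: "mult (scale c x) y = scale c (mult x y)"
    and mult_scale_right: "mult x (scale c y) = scale c (mult x y)"
    and leibniz: "mult x (mult y z) = mult (mult x y) z - mult (mult x z) y"
begin

text \<open>
  An extension of an abelian algebra by an abelian one: an abelian ideal \<open>I\<close> with abelian quotient.
  The quotient by \<open>I\<close> is abelian iff \<open>I\<close> contains all products, and a subspace with this property
  is automatically an ideal.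
\<close>
definition metabelian :: bool where
  "metabelian \<longleftrightarrow>
    (\<exists>I. subspace I \<and> (\<forall>x y. mult x y \<in> I) \<and> (\<forall>x\<in>I. \<forall>y\<in>I. mult x y = 0))"

lemma mult_zero_left: "mult 0 y = 0"
  using mult_add_left[of 0 0 y] by simp

lemma mult_zero_right: "mult x 0 = 0"
  using mult_add_right[of x 0 0] by simp

lemma metabelian_iff: "metabelian \<longleftrightarrow> (\<forall>x y z w. mult (mult x y) (mult z w) = 0)"
proof
  assume "metabelian"
  then show "\<forall>x y z w. mult (mult x y) (mult z w) = 0"
    unfolding metabelian_def by blast
next
  assume vanish: "\<forall>x y z w. mult (mult x y) (mult z w) = 0"
  let ?I = "span {mult x y | x y. True}"
  have base: "mult (mult x y) b = 0" if "b \<in> ?I" for x y b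
    using that
    by (induction rule: span_induct_alt)
      (use vanish in \<open>auto simp: mult_zero_right mult_add_right mult_scale_right\<close>)
  have "mult a b = 0" if "a \<in> ?I" "b \<in> ?I" for a b
    using that(1)
    by (induction rule: span_induct_alt)
      (use base[OF that(2)] in \<open>auto simp: mult_zero_left mult_add_left mult_scale_left\<close>)
  moreover have "mult x y \<in> ?I" for x y
    by (rule span_base) blast
  ultimately show "metabelian"
    unfolding metabelian_def by (intro exI[of _ ?I]) (simp add: subspace_span)
qed

end

text \<open>The left-normed product \<open>[f\<^sub>1 \<dots> f\<^sub>n]\<^sub>L\<close>, for a nonempty list of factors.\<close>
definition lnormed :: "('v \<Rightarrow> 'v \<Rightarrow> 'v) \<Rightarrow> 'v list \<Rightarrow> 'v" where
  "lnormed mult fs = foldl mult (hd fs) (tl fs)"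


section \<open>Leibniz algebras given by generators and relations\<close>

text \<open>
  Free algebras are constructed as term algebras modulo the congruence generated by the axioms of
  \<open>leibniz_algebra\<close> together with a set \<open>E\<close> of further equations. The universal properties are
  proved below.
\<close>
datatype ('k, 'x) lterm =
    Gen 'x
  | Zero
  | Add "('k, 'x) lterm" "('k, 'x) lterm"
  | Neg "('k, 'x) lterm"
  | Scale 'k "('k, 'x) lterm"
  | Mult "('k, 'x) lterm" "('k, 'x) lterm"

inductive leib_cong ::
  "(('k::field, 'x) lterm \<times> ('k, 'x) lterm) set \<Rightarrow> ('k, 'x) lterm \<Rightarrow> ('k, 'x) lterm \<Rightarrow> bool"
  for E
where
  rel: "(s, t) \<in> E \<Longrightarrow> leib_cong E s t"
| refl: "leib_cong E t t"
| sym: "leib_cong E s t \<Longrightarrow> leib_cong E t s"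
| trans: "leib_cong E s t \<Longrightarrow> leib_cong E t u \<Longrightarrow> leib_cong E s u"
| cong_Add: "leib_cong E s s' \<Longrightarrow> leib_cong E t t' \<Longrightarrow> leib_cong E (Add s t) (Add s' t')"
| cong_Neg: "leib_cong E t t' \<Longrightarrow> leib_cong E (Neg t) (Neg t')"
| cong_Scale: "leib_cong E t t' \<Longrightarrow> leib_cong E (Scale c t) (Scale c t')"
| cong_Mult: "leib_cong E s s' \<Longrightarrow> leib_cong E t t' \<Longrightarrow> leib_cong E (Mult s t) (Mult s' t')"
| add_assoc: "leib_cong E (Add (Add s t) u) (Add s (Add t u))"
| add_commute: "leib_cong E (Add s t) (Add t s)"
| add_Zero: "leib_cong E (Add Zero t) t"
| add_Neg: "leib_cong E (Add (Neg t) t) Zero"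
| scale_add_right: "leib_cong E (Scale c (Add s t)) (Add (Scale c s) (Scale c t))"
| scale_add_left: "leib_cong E (Scale (c + d) t) (Add (Scale c t) (Scale d t))"
| scale_scale: "leib_cong E (Scale c (Scale d t)) (Scale (c * d) t)"
| scale_one: "leib_cong E (Scale 1 t) t"
| mult_add_left: "leib_cong E (Mult (Add s t) u) (Add (Mult s u) (Mult t u))"
| mult_add_right: "leib_cong E (Mult s (Add t u)) (Add (Mult s t) (Mult s u))"
| mult_scale_left: "leib_cong E (Mult (Scale c s) t) (Scale c (Mult s t))"
| mult_scale_right: "leib_cong E (Mult s (Scale c t)) (Scale c (Mult s t))"
| leibniz: "leib_cong E (Mult s (Mult t u)) (Add (Mult (Mult s t) u) (Neg (Mult (Mult s u) t)))"

lemma equivp_leib_cong: "equivp (leib_cong E)"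
  by (intro equivpI reflpI sympI transpI) (blast intro: leib_cong.refl leib_cong.sym leib_cong.trans)+

context leibniz_algebra
begin

primrec eval_lterm :: "('x \<Rightarrow> 'v) \<Rightarrow> ('k, 'x) lterm \<Rightarrow> 'v" where
  "eval_lterm \<phi> (Gen x) = \<phi> x"
| "eval_lterm \<phi> Zero = 0"
| "eval_lterm \<phi> (Add s t) = eval_lterm \<phi> s + eval_lterm \<phi> t"
| "eval_lterm \<phi> (Neg t) = - eval_lterm \<phi> t"
| "eval_lterm \<phi> (Scale c t) = scale c (eval_lterm \<phi> t)"
| "eval_lterm \<phi> (Mult s t) = mult (eval_lterm \<phi> s) (eval_lterm \<phi> t)"

lemma eval_lterm_cong:
  assumes "leib_cong E s t" and "\<And>s t. (s, t) \<in> E \<Longrightarrow> eval_lterm \<phi> s = eval_lterm \<phi> t"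
  shows "eval_lterm \<phi> s = eval_lterm \<phi> t"
  using assms(1)
  by (induction rule: leib_cong.induct)
    (auto simp: assms(2) scale_right_distrib scale_left_distrib mult_add_left mult_add_right
      mult_scale_left mult_scale_right leibniz add_ac)

end


subsection \<open>The free Leibniz algebra\<close>

quotient_type (overloaded) ('k, 'x) lb = "('k::field, 'x) lterm" / "leib_cong {}"
  by (rule equivp_leib_cong)

instantiation lb :: (field, type) ab_group_add
begin

lift_definition zero_lb :: "('a, 'b) lb" is Zero .
lift_definition plus_lb :: "('a, 'b) lb \<Rightarrow> ('a, 'b) lb \<Rightarrow> ('a, 'b) lb" is Add
  by (rule leib_cong.cong_Add)
lift_definition uminus_lb :: "('a, 'b) lb \<Rightarrow> ('a, 'b) lb" is Neg
  by (rule leib_cong.cong_Neg)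
definition minus_lb :: "('a, 'b) lb \<Rightarrow> ('a, 'b) lb \<Rightarrow> ('a, 'b) lb" where
  "minus_lb f g = f + (- g)"

instance
proof
  fix f g h :: "('a, 'b) lb"
  show "f + g + h = f + (g + h)" by transfer (rule leib_cong.add_assoc)
  show "f + g = g + f" by transfer (rule leib_cong.add_commute)
  show "0 + f = f" by transfer (rule leib_cong.add_Zero)
  show "- f + f = 0" by transfer (rule leib_cong.add_Neg)
  show "f - g = f + - g" by (fact minus_lb_def)
qed

end

lift_definition lb_gen :: "'x \<Rightarrow> ('k::field, 'x) lb" is Gen .
lift_definition lb_scale :: "'k \<Rightarrow> ('k::field, 'x) lb \<Rightarrow> ('k, 'x) lb" is Scale
  by (rule leib_cong.cong_Scale)
lift_definition lb_mult :: "('k::field, 'x) lb \<Rightarrow> ('k, 'x) lb \<Rightarrow> ('k, 'x) lb" is Mult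
  by (rule leib_cong.cong_Mult)

global_interpretation lb: leibniz_algebra lb_scale lb_mult
proof
  fix c d :: 'a and f g h :: "('a, 'b) lb"
  show "lb_scale c (f + g) = lb_scale c f + lb_scale c g"
    by transfer (rule leib_cong.scale_add_right)
  show "lb_scale (c + d) f = lb_scale c f + lb_scale d f"
    by transfer (rule leib_cong.scale_add_left)
  show "lb_scale c (lb_scale d f) = lb_scale (c * d) f"
    by transfer (rule leib_cong.scale_scale)
  show "lb_scale 1 f = f" by transfer (rule leib_cong.scale_one)
  show "lb_mult (f + g) h = lb_mult f h + lb_mult g h"
    by transfer (rule leib_cong.mult_add_left)
  show "lb_mult f (g + h) = lb_mult f g + lb_mult f h"
    by transfer (rule leib_cong.mult_add_right)
  show "lb_mult (lb_scale c f) g = lb_scale c (lb_mult f g)"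
    by transfer (rule leib_cong.mult_scale_left)
  show "lb_mult f (lb_scale c g) = lb_scale c (lb_mult f g)"
    by transfer (rule leib_cong.mult_scale_right)
  show "lb_mult f (lb_mult g h) = lb_mult (lb_mult f g) h - lb_mult (lb_mult f h) g"
    unfolding minus_lb_def by transfer (rule leib_cong.leibniz)
qed

theorem (in leibniz_algebra) lb_universal:
  fixes \<phi> :: "'x \<Rightarrow> 'v"
  shows "\<exists>!h :: ('k, 'x) lb \<Rightarrow> 'v. Vector_Spaces.linear lb_scale scale h \<and>
    (\<forall>f g. h (lb_mult f g) = mult (h f) (h g)) \<and> (\<forall>x. h (lb_gen x) = \<phi> x)"
proof (rule ex1I)
  let ?P = "\<lambda>h :: ('k, 'x) lb \<Rightarrow> 'v. Vector_Spaces.linear lb_scale scale h \<and>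
    (\<forall>f g. h (lb_mult f g) = mult (h f) (h g)) \<and> (\<forall>x. h (lb_gen x) = \<phi> x)"
  define h :: "('k, 'x) lb \<Rightarrow> 'v" where "h f = eval_lterm \<phi> (rep_lb f)" for f
  have abs: "h (abs_lb t) = eval_lterm \<phi> t" for t
    unfolding h_def
    by (rule eval_lterm_cong[where E = "{}"])
      (auto intro: rep_abs_rsp[OF Quotient3_lb] leib_cong.refl leib_cong.sym)
  have ind: "f = abs_lb (rep_lb f)" for f :: "('k, 'x) lb"
    by (simp add: Quotient3_abs_rep[OF Quotient3_lb])
  show Ph: "?P h"
  proof (intro conjI allI)
    show "Vector_Spaces.linear lb_scale scale h"
    proof (unfold_locales)
      fix c and f g :: "('k, 'x) lb"
      show "h (f + g) = h f + h g"
        by (subst (1 2) ind, subst plus_lb.abs_eq) (simp add: abs, simp add: h_def)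
      show "h (lb_scale c f) = scale c (h f)"
        by (subst (1) ind, subst lb_scale.abs_eq) (simp add: abs, simp add: h_def)
    qed
    show "h (lb_mult f g) = mult (h f) (h g)" for f g
      by (subst (1 2) ind, subst lb_mult.abs_eq) (simp add: abs, simp add: h_def)
    show "h (lb_gen x) = \<phi> x" for x
      by (simp add: lb_gen.abs_eq abs)
  qed
  fix h' assume Ph': "?P h'"
  have hom: "module_hom lb_scale scale h" "module_hom lb_scale scale h'"
    using Ph Ph' by (simp_all add: linear_iff_module_hom)
  have "h' (abs_lb t) = h (abs_lb t)" for t
  proof (induction t)
    case (Gen x) show ?case using Ph Ph' by (simp add: lb_gen.abs_eq[symmetric])
  next
    case Zero show ?case
      by (simp add: zero_lb.abs_eq[symmetric] hom[THEN module_hom.zero])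
  next
    case (Add s t) then show ?case
      by (simp add: plus_lb.abs_eq[symmetric] hom[THEN module_hom.add])
  next
    case (Neg t) then show ?case
      by (simp add: uminus_lb.abs_eq[symmetric] hom[THEN module_hom.neg])
  next
    case (Scale c t) then show ?case
      by (simp add: lb_scale.abs_eq[symmetric] hom[THEN module_hom.scale])
  next
    case (Mult s t) then show ?case using Ph Ph' by (simp add: lb_mult.abs_eq[symmetric])
  qed
  then show "h' = h" by (metis ind ext)
qed


subsection \<open>The free metabelian Leibniz algebra\<close>

definition metab_rels :: "(('k, 'x) lterm \<times> ('k, 'x) lterm) set" where
  "metab_rels = {(Mult (Mult s t) (Mult u v), Zero) | s t u v. True}"

quotient_type (overloaded) ('k, 'x) mlb = "('k::field, 'x) lterm" / "leib_cong metab_rels"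
  by (rule equivp_leib_cong)

instantiation mlb :: (field, type) ab_group_add
begin

lift_definition zero_mlb :: "('a, 'b) mlb" is Zero .
lift_definition plus_mlb :: "('a, 'b) mlb \<Rightarrow> ('a, 'b) mlb \<Rightarrow> ('a, 'b) mlb" is Add
  by (rule leib_cong.cong_Add)
lift_definition uminus_mlb :: "('a, 'b) mlb \<Rightarrow> ('a, 'b) mlb" is Neg
  by (rule leib_cong.cong_Neg)
definition minus_mlb :: "('a, 'b) mlb \<Rightarrow> ('a, 'b) mlb \<Rightarrow> ('a, 'b) mlb" where
  "minus_mlb f g = f + (- g)"

instance
proof
  fix f g h :: "('a, 'b) mlb"
  show "f + g + h = f + (g + h)" by transfer (rule leib_cong.add_assoc)
  show "f + g = g + f" by transfer (rule leib_cong.add_commute)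
  show "0 + f = f" by transfer (rule leib_cong.add_Zero)
  show "- f + f = 0" by transfer (rule leib_cong.add_Neg)
  show "f - g = f + - g" by (fact minus_mlb_def)
qed

end

lift_definition mlb_gen :: "'x \<Rightarrow> ('k::field, 'x) mlb" is Gen .
lift_definition mlb_scale :: "'k \<Rightarrow> ('k::field, 'x) mlb \<Rightarrow> ('k, 'x) mlb" is Scale
  by (rule leib_cong.cong_Scale)
lift_definition mlb_mult :: "('k::field, 'x) mlb \<Rightarrow> ('k, 'x) mlb \<Rightarrow> ('k, 'x) mlb" is Mult
  by (rule leib_cong.cong_Mult)

global_interpretation mlb: leibniz_algebra mlb_scale mlb_mult
proof
  fix c d :: 'a and f g h :: "('a, 'b) mlb"
  show "mlb_scale c (f + g) = mlb_scale c f + mlb_scale c g"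
    by transfer (rule leib_cong.scale_add_right)
  show "mlb_scale (c + d) f = mlb_scale c f + mlb_scale d f"
    by transfer (rule leib_cong.scale_add_left)
  show "mlb_scale c (mlb_scale d f) = mlb_scale (c * d) f"
    by transfer (rule leib_cong.scale_scale)
  show "mlb_scale 1 f = f" by transfer (rule leib_cong.scale_one)
  show "mlb_mult (f + g) h = mlb_mult f h + mlb_mult g h"
    by transfer (rule leib_cong.mult_add_left)
  show "mlb_mult f (g + h) = mlb_mult f g + mlb_mult f h"
    by transfer (rule leib_cong.mult_add_right)
  show "mlb_mult (mlb_scale c f) g = mlb_scale c (mlb_mult f g)"
    by transfer (rule leib_cong.mult_scale_left)
  show "mlb_mult f (mlb_scale c g) = mlb_scale c (mlb_mult f g)"
    by transfer (rule leib_cong.mult_scale_right)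
  show "mlb_mult f (mlb_mult g h) = mlb_mult (mlb_mult f g) h - mlb_mult (mlb_mult f h) g"
    unfolding minus_mlb_def by transfer (rule leib_cong.leibniz)
qed

theorem mlb_metabelian: "leibniz_algebra.metabelian mlb_scale mlb_mult"
proof -
  have "mlb_mult (mlb_mult f g) (mlb_mult h k) = 0" for f g h k :: "('a, 'b) mlb"
    by transfer (rule leib_cong.rel, auto simp: metab_rels_def)
  then show ?thesis by (simp add: mlb.metabelian_iff)
qed

theorem (in leibniz_algebra) mlb_universal:
  fixes \<phi> :: "'x \<Rightarrow> 'v"
  assumes metabelian
  shows "\<exists>!h :: ('k, 'x) mlb \<Rightarrow> 'v. Vector_Spaces.linear mlb_scale scale h \<and>
    (\<forall>f g. h (mlb_mult f g) = mult (h f) (h g)) \<and> (\<forall>x. h (mlb_gen x) = \<phi> x)"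
proof (rule ex1I)
  let ?P = "\<lambda>h :: ('k, 'x) mlb \<Rightarrow> 'v. Vector_Spaces.linear mlb_scale scale h \<and>
    (\<forall>f g. h (mlb_mult f g) = mult (h f) (h g)) \<and> (\<forall>x. h (mlb_gen x) = \<phi> x)"
  define h :: "('k, 'x) mlb \<Rightarrow> 'v" where "h f = eval_lterm \<phi> (rep_mlb f)" for f
  have vanish: "eval_lterm \<phi> s = eval_lterm \<phi> t" if "(s, t) \<in> metab_rels" for s t :: "('k, 'x) lterm"
    using that assms by (auto simp: metab_rels_def metabelian_iff)
  have abs: "h (abs_mlb t) = eval_lterm \<phi> t" for t
    unfolding h_def
    by (rule eval_lterm_cong[where E = metab_rels])
      (auto intro: rep_abs_rsp[OF Quotient3_mlb] leib_cong.refl leib_cong.sym vanish)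
  have ind: "f = abs_mlb (rep_mlb f)" for f :: "('k, 'x) mlb"
    by (simp add: Quotient3_abs_rep[OF Quotient3_mlb])
  show Ph: "?P h"
  proof (intro conjI allI)
    show "Vector_Spaces.linear mlb_scale scale h"
    proof (unfold_locales)
      fix c and f g :: "('k, 'x) mlb"
      show "h (f + g) = h f + h g"
        by (subst (1 2) ind, subst plus_mlb.abs_eq) (simp add: abs, simp add: h_def)
      show "h (mlb_scale c f) = scale c (h f)"
        by (subst (1) ind, subst mlb_scale.abs_eq) (simp add: abs, simp add: h_def)
    qed
    show "h (mlb_mult f g) = mult (h f) (h g)" for f g
      by (subst (1 2) ind, subst mlb_mult.abs_eq) (simp add: abs, simp add: h_def)
    show "h (mlb_gen x) = \<phi> x" for x
      by (simp add: mlb_gen.abs_eq abs)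
  qed
  fix h' assume Ph': "?P h'"
  have hom: "module_hom mlb_scale scale h" "module_hom mlb_scale scale h'"
    using Ph Ph' by (simp_all add: linear_iff_module_hom)
  have "h' (abs_mlb t) = h (abs_mlb t)" for t
  proof (induction t)
    case (Gen x) show ?case using Ph Ph' by (simp add: mlb_gen.abs_eq[symmetric])
  next
    case Zero show ?case
      by (simp add: zero_mlb.abs_eq[symmetric] hom[THEN module_hom.zero])
  next
    case (Add s t) then show ?case
      by (simp add: plus_mlb.abs_eq[symmetric] hom[THEN module_hom.add])
  next
    case (Neg t) then show ?case
      by (simp add: uminus_mlb.abs_eq[symmetric] hom[THEN module_hom.neg])
  next
    case (Scale c t) then show ?case
      by (simp add: mlb_scale.abs_eq[symmetric] hom[THEN module_hom.scale])
  next
    case (Mult s t) then show ?case using Ph Ph' by (simp add: mlb_mult.abs_eq[symmetric])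
  qed
  then show "h' = h" by (metis ind ext)
qed


section \<open>Leading monomials\<close>

text \<open>
  Monomials \<open>[a\<^sub>1 \<dots> a\<^sub>n]\<^sub>L\<close> are referred to by their words \<open>[a\<^sub>1, \<dots>, a\<^sub>n]\<close>, \<open>n \<ge> 1\<close>. All generators
  have degree 1, so degree and length of a monomial are both the length of its word.
\<close>
definition lb_nf :: "'x list \<Rightarrow> ('k::field, 'x) lb" where
  "lb_nf w = lnormed lb_mult (map lb_gen w)"

definition mlb_nf :: "'x list \<Rightarrow> ('k::field, 'x) mlb" where
  "mlb_nf w = lnormed mlb_mult (map mlb_gen w)"

definition NF :: "('k::field, 'x) lb set" where
  "NF = lb_nf ` {w. w \<noteq> []}"

definition word_less :: "'x::wellorder list \<Rightarrow> 'x list \<Rightarrow> bool" where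
  "word_less u v \<longleftrightarrow> (u, v) \<in> lenlex {(a, b). a < b}"

definition lb_coeff :: "('k::field, 'x) lb \<Rightarrow> 'x list \<Rightarrow> 'k" where
  "lb_coeff f w = lb.representation NF f (lb_nf w)"

definition lead :: "('k::field, 'x::wellorder) lb \<Rightarrow> 'x list" where
  "lead f = (THE w. w \<noteq> [] \<and> lb_coeff f w \<noteq> 0 \<and>
     (\<forall>v. v \<noteq> [] \<and> lb_coeff f v \<noteq> 0 \<longrightarrow> v = w \<or> word_less v w))"

definition monic :: "('k::field, 'x::wellorder) lb \<Rightarrow> bool" where
  "monic f \<longleftrightarrow> f \<noteq> 0 \<and> lb_coeff f (lead f) = 1"


section \<open>Groebner--Shirshov bases\<close>

text \<open>\<open>normal_poly s h\<close>: \<open>h\<close> is one of the normal polynomials \<open>h\<^sub>s\<close>.\<close>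
inductive normal_poly :: "('k::field, 'x::wellorder) lb \<Rightarrow> ('k, 'x) lb \<Rightarrow> bool" for s where
  "normal_poly s (lnormed lb_mult (s # map lb_gen as))"
| "length (lead s) = 1 \<Longrightarrow> as \<noteq> [] \<Longrightarrow>
    normal_poly s (lnormed lb_mult (map lb_gen as @ s # map lb_gen bs))"

definition trivial_below :: "('k::field, 'x::wellorder) lb set \<Rightarrow> 'x list \<Rightarrow> ('k, 'x) lb \<Rightarrow> bool" where
  "trivial_below S w f \<longleftrightarrow> f \<in> lb.span {h. \<exists>s\<in>S. normal_poly s h \<and> word_less (lead h) w}"

definition trivial_deg :: "('k::field, 'x::wellorder) lb set \<Rightarrow> nat \<Rightarrow> ('k, 'x) lb \<Rightarrow> bool" where
  "trivial_deg S n f \<longleftrightarrow> f \<in> lb.span {h. \<exists>s\<in>S. normal_poly s h \<and> length (lead h) \<le> n}"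

definition GS_basis :: "('k::field, 'x::wellorder) lb set \<Rightarrow> bool" where
  "GS_basis S \<longleftrightarrow>
    (\<forall>f\<in>S. monic f) \<and>
    (\<forall>f\<in>S. \<forall>g\<in>S. \<forall>h. f \<noteq> g \<and> normal_poly g h \<and> lead f = lead h \<longrightarrow>
      trivial_below S (lead f) (f - h)) \<and>
    (\<forall>f\<in>S. \<forall>u. length (lead f) > 1 \<and> u \<noteq> [] \<and> lb_mult (lb_nf u) f \<noteq> 0 \<longrightarrow>
      trivial_deg S (length u + length (lead f)) (lb_mult (lb_nf u) f))"

end

theory Submission
  imports Defs "HOL-Library.Poly_Mapping" "HOL-Library.Multiset" "HOL-Library.Product_Plus"
begin

text \<open>
  The Leibniz identity makes every product of left-normed words a combination of left-normed words,
  and in a metabelian algebra it lets adjacent letters from the third position on be exchanged, since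
  \<open>[c\<^sub>1 \<dots> c\<^sub>p a b]\<^sub>L - [c\<^sub>1 \<dots> c\<^sub>p b a]\<^sub>L = [c\<^sub>1 \<dots> c\<^sub>p]\<^sub>L (a b)\<close>; this gives spanning. Linear independence is
  read off from explicit models in which each normal word is sent to its own monomial: a
  hemisemidirect product over the free associative algebra for the free Leibniz algebra, and
  a commutative matrix version of it in the metabelian case. For the Groebner--Shirshov property,
  words are rewritten downwards to the form sorted from the third letter on, so two smaller words
  with a common sorted form are congruent below the larger word. Left multiplication is handled by
  \<open>u (c (a b)) = (u c) (a b) - (u (a b)) c\<close>.
\<close>

section \<open>Left-normed products\<close>

lemma lnormed_singleton [simp]: "lnormed f [x] = x"
  by (simp add: lnormed_def)

lemma lnormed_snoc:
  "xs \<noteq> [] \<Longrightarrow> lnormed f (xs @ [y]) = f (lnormed f xs) y"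
  by (simp add: lnormed_def)

lemma lnormed_append:
  "xs \<noteq> [] \<Longrightarrow> lnormed f (xs @ ys) = foldl f (lnormed f xs) ys"
  by (simp add: lnormed_def)

lemma hom_lnormed:
  assumes "\<And>x y. h (f x y) = g (h x) (h y)" and "xs \<noteq> []"
  shows "h (lnormed f xs) = lnormed g (map h xs)"
  using assms(2) by (induction xs rule: rev_nonempty_induct) (simp_all add: lnormed_snoc assms(1))

lemma (in module) span_mono_mem: "x \<in> span A \<Longrightarrow> A \<subseteq> B \<Longrightarrow> x \<in> span B"
  using span_mono by blast

context leibniz_algebra
begin

lemma mult_diff_left: "mult (x - y) z = mult x z - mult y z"
  using mult_add_left[of "x - y" y z] by simp

lemma span_mult_left:
  assumes "f \<in> span A" and "\<And>a. a \<in> A \<Longrightarrow> mult a g \<in> span B"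
  shows "mult f g \<in> span B"
  using assms(1)
  by (induction rule: span_induct_alt)
    (auto simp: mult_zero_left mult_add_left mult_scale_left
      intro!: span_zero span_add span_scale assms(2))

lemma span_mult_right:
  assumes "g \<in> span A" and "\<And>a. a \<in> A \<Longrightarrow> mult f a \<in> span B"
  shows "mult f g \<in> span B"
  using assms(1)
  by (induction rule: span_induct_alt)
    (auto simp: mult_zero_right mult_add_right mult_scale_right
      intro!: span_zero span_add span_scale assms(2))

text \<open>Induction on the right factor: \<open>u (v x) = (u v) x - (u x) v\<close>, and both
  products on the right involve the shorter factor \<open>v\<close>. The exact word length is
  recorded for the degree bounds of the Groebner--Shirshov property.\<close>

lemma mult_lnormed_in_span:
  fixes \<phi> :: "'x \<Rightarrow> 'v"
  assumes "v \<noteq> []" and "u \<noteq> []"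
  shows "mult (lnormed mult (map \<phi> u)) (lnormed mult (map \<phi> v))
    \<in> span {lnormed mult (map \<phi> w) | w. length w = length u + length v}"
  using assms
proof (induction v arbitrary: u rule: rev_nonempty_induct)
  case (single x)
  have "mult (lnormed mult (map \<phi> u)) (\<phi> x) = lnormed mult (map \<phi> (u @ [x]))"
    using single by (simp add: lnormed_snoc)
  then show ?case
    by (auto intro!: span_base exI[of _ "u @ [x]"])
next
  case (snoc x v)
  let ?n = "\<lambda>w. lnormed mult (map \<phi> w)"
  let ?B = "{?n w | w. length w = length u + length (v @ [x])}"
  have "mult (mult (?n u) (?n v)) (\<phi> x) \<in> span ?B"
  proof (rule span_mult_left[OF snoc.IH[OF snoc.prems]], safe)
    fix w :: "'x list" assume w: "length w = length u + length v"
    with snoc.prems have "w \<noteq> []" by auto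
    then have "mult (?n w) (\<phi> x) = ?n (w @ [x])"
      by (simp add: lnormed_snoc)
    with w show "mult (?n w) (\<phi> x) \<in> span ?B"
      by (auto intro!: span_base exI[of _ "w @ [x]"])
  qed
  \<comment> \<open>The letter \<open>x\<close> moves to the left factor, so the induction
    hypothesis is used at \<open>u @ [x]\<close>.\<close>
  moreover have "mult (mult (?n u) (\<phi> x)) (?n v) \<in> span ?B"
    using snoc.IH[of "u @ [x]"] snoc.prems by (simp add: lnormed_snoc)
  ultimately show ?case
    using snoc.hyps by (simp add: lnormed_snoc leibniz span_diff)
qed

lemma eval_lterm_in_span:
  "eval_lterm \<phi> t \<in> span {lnormed mult (map \<phi> w) | w. w \<noteq> []}" (is "_ \<in> span ?B")
proof (induction t)
  case (Gen x)
  show ?case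
    by (auto intro!: span_base exI[of _ "[x]"])
next
  case (Mult s t)
  have "mult b c \<in> span ?B" if "b \<in> ?B" "c \<in> ?B" for b c
    using that by (auto intro!: span_mono_mem[OF mult_lnormed_in_span])
  then have "mult b (eval_lterm \<phi> t) \<in> span ?B" if "b \<in> ?B" for b
    using that by (intro span_mult_right[OF Mult(2)])
  then show ?case
    by (auto intro: span_mult_left[OF Mult(1)])
qed (auto intro: span_zero span_add span_neg span_scale)

end

lemma abs_lb_eq_eval: "abs_lb t = lb.eval_lterm lb_gen t"
  by (induction t) (simp_all flip: lb_gen.abs_eq zero_lb.abs_eq plus_lb.abs_eq uminus_lb.abs_eq
    lb_scale.abs_eq lb_mult.abs_eq)

lemma abs_mlb_eq_eval: "abs_mlb t = mlb.eval_lterm mlb_gen t"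
  by (induction t) (simp_all flip: mlb_gen.abs_eq zero_mlb.abs_eq plus_mlb.abs_eq
    uminus_mlb.abs_eq mlb_scale.abs_eq mlb_mult.abs_eq)

lemma span_NF: "lb.span NF = UNIV"
proof (rule UNIV_eq_I[symmetric])
  fix f :: "('a, 'b) lb"
  have "f = lb.eval_lterm lb_gen (rep_lb f)"
    by (simp add: Quotient3_abs_rep[OF Quotient3_lb] flip: abs_lb_eq_eval)
  also have "\<dots> \<in> lb.span NF"
    using lb.eval_lterm_in_span by (simp add: NF_def lb_nf_def image_Collect)
  finally show "f \<in> lb.span NF" .
qed

lemma span_mlb_nf: "mlb.span {mlb_nf w | w. w \<noteq> []} = UNIV"
proof (rule UNIV_eq_I[symmetric])
  fix f :: "('a, 'b) mlb"
  have "f = mlb.eval_lterm mlb_gen (rep_mlb f)"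
    by (simp add: Quotient3_abs_rep[OF Quotient3_mlb] flip: abs_mlb_eq_eval)
  also have "\<dots> \<in> mlb.span {mlb_nf w | w. w \<noteq> []}"
    using mlb.eval_lterm_in_span by (simp add: mlb_nf_def)
  finally show "f \<in> mlb.span {mlb_nf w | w. w \<noteq> []}" .
qed


section \<open>Linear independence of normal words\<close>

text \<open>The coefficient of \<open>F\<close> at \<open>g w\<close> is a linear functional with
  value 1 at \<open>b w\<close> and 0 at every other \<open>b v\<close>, so \<open>b w\<close>
  cannot lie in the span of the others.\<close>

lemma (in vector_space) independent_image_if_monomials:
  fixes F :: "'b \<Rightarrow> 'm \<Rightarrow>\<^sub>0 'a" and b :: "'w \<Rightarrow> 'b" and g :: "'w \<Rightarrow> 'm"
  assumes add: "\<And>x y. F (x + y) = F x + F y"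
    and scale: "\<And>c x m. Poly_Mapping.lookup (F (scale c x)) m = c * Poly_Mapping.lookup (F x) m"
    and mono: "\<And>w. w \<in> D \<Longrightarrow> F (b w) = Poly_Mapping.single (g w) 1"
    and inj: "inj_on g D"
  shows "inj_on b D" and "independent (b ` D)"
proof -
  have eq: "v = w" if "Poly_Mapping.lookup (F (b v)) (g w) \<noteq> 0" "v \<in> D" "w \<in> D" for v w
    using that inj by (auto simp: mono lookup_single when_def inj_on_def split: if_splits)
  show "inj_on b D"
    by (rule inj_onI, rule eq) (simp_all add: mono)
  show "independent (b ` D)"
    unfolding dependent_def
  proof safe
    fix w assume w: "w \<in> D" and dep: "b w \<in> span (b ` D - {b w})"
    have F0: "F 0 = 0"
      using add[of 0 0] by simp
    from dep have "Poly_Mapping.lookup (F (b w)) (g w) = 0"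
    proof (induction rule: span_induct_alt)
      case (step c x y)
      then show ?case
        using eq[OF _ _ w] by (auto simp: add lookup_add scale)
    qed (simp add: F0)
    then show False
      using w by (simp add: mono)
  qed
qed

text \<open>
  A copy of the type of lists that may carry the additive notation which \<^typ>\<open>'a \<Rightarrow>\<^sub>0 'b\<close> expects of
  exponents, so that \<open>'x word \<Rightarrow>\<^sub>0 'k\<close> is the free associative algebra.
\<close>
datatype 'x word = Word "'x list"

instantiation word :: (type) monoid_add
begin

definition zero_word :: "'a word" where
  "zero_word = Word []"

fun plus_word :: "'a word \<Rightarrow> 'a word \<Rightarrow> 'a word" where
  "plus_word (Word u) (Word v) = Word (u @ v)"

instance
proof
  fix u v w :: "'a word"
  show "u + v + w = u + (v + w)" by (cases u; cases v; cases w) simp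
  show "0 + u = u" by (cases u) (simp add: zero_word_def)
  show "u + 0 = u" by (cases u) (simp add: zero_word_def)
qed

end

abbreviation pm_const :: "'k \<Rightarrow> 'm::zero \<Rightarrow>\<^sub>0 'k::zero" where
  "pm_const \<equiv> Poly_Mapping.single 0"

lemma lookup_pm_const_times:
  fixes p :: "'m::monoid_add \<Rightarrow>\<^sub>0 'k::comm_semiring_0"
  shows "Poly_Mapping.lookup (pm_const c * p) m = c * Poly_Mapping.lookup p m"
  unfolding mult_map_scale_conv_mult[symmetric] by transfer (auto simp: when_def)

text \<open>The exponent 0 is neutral on both sides, so scalars commute with monomials even when
  exponents do not commute. This is what makes \<open>hemi_mult\<close> bilinear.\<close>

lemma pm_const_central:
  fixes p :: "'m::monoid_add \<Rightarrow>\<^sub>0 'k::comm_semiring_0"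
  shows "p * pm_const c = pm_const c * p"
proof (induction p rule: update_induct)
  case (update p m d)
  have "Poly_Mapping.update m d p = p + Poly_Mapping.single m d"
    using update(1)
    by (intro poly_mapping_eqI) (auto simp: lookup_update lookup_add lookup_single when_def in_keys_iff)
  then show ?case
    using update(3) by (simp add: distrib_left distrib_right mult_single mult.commute)
qed simp

lemma pm_const_mult: "pm_const (c * d) = pm_const c * (pm_const d :: 'm::monoid_add \<Rightarrow>\<^sub>0 'k::semiring_0)"
  by (simp add: mult_single)

text \<open>
  The hemisemidirect product of the commutator Lie algebra of an associative algebra with the
  algebra itself as right module.
\<close>
fun hemi_mult :: "'a::ring \<times> 'a \<Rightarrow> 'a \<times> 'a \<Rightarrow> 'a \<times> 'a" where
  "hemi_mult (x, m) (y, n) = (x * y - y * x, m * y)"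

definition hemi_scale :: "'k \<Rightarrow> ('m::monoid_add \<Rightarrow>\<^sub>0 'k::field) \<times> ('m \<Rightarrow>\<^sub>0 'k) \<Rightarrow> ('m \<Rightarrow>\<^sub>0 'k) \<times> ('m \<Rightarrow>\<^sub>0 'k)"
  where "hemi_scale c = map_prod ((*) (pm_const c)) ((*) (pm_const c))"

text \<open>The Leibniz identity is the Jacobi identity for commutators in the first component and
  the module law \<open>m [y, z] = (m y) z - (m z) y\<close> in the second.\<close>

lemma leibniz_algebra_hemi: "leibniz_algebra hemi_scale hemi_mult"
proof
  fix c d :: 'a and f g h :: "('b \<Rightarrow>\<^sub>0 'a) \<times> ('b \<Rightarrow>\<^sub>0 'a)"
  have swap: "p * (pm_const c * q) = pm_const c * (p * q)" for p q :: "'b \<Rightarrow>\<^sub>0 'a"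
    by (metis mult.assoc pm_const_central)
  show "hemi_mult f (hemi_scale c g) = hemi_scale c (hemi_mult f g)"
    by (cases f; cases g) (simp add: hemi_scale_def swap algebra_simps)
  show "hemi_mult (hemi_scale c f) g = hemi_scale c (hemi_mult f g)"
    by (cases f; cases g) (simp add: hemi_scale_def swap algebra_simps)
qed (auto simp: hemi_scale_def single_add pm_const_mult algebra_simps)

lemma lnormed_hemi:
  assumes "w \<noteq> []"
  shows "snd (lnormed hemi_mult (map (\<lambda>x. (Poly_Mapping.single (Word [x]) 1, Poly_Mapping.single (Word [x]) 1)) w))
    = Poly_Mapping.single (Word w) (1 :: 'k::field)"
  using assms
proof (induction w rule: rev_nonempty_induct)
  case (snoc x w)
  let ?p = "lnormed hemi_mult (map (\<lambda>x. (Poly_Mapping.single (Word [x]) 1, Poly_Mapping.single (Word [x]) (1::'k))) w)"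
  show ?case
    using snoc by (cases ?p) (simp add: lnormed_snoc mult_single)
qed simp

text \<open>Sending each generator \<open>x\<close> to \<open>(x, x)\<close> extends to a
  homomorphism into the hemisemidirect product, whose second component maps a normal word to its
  associative monomial.\<close>

lemma inj_lb_nf: "inj_on (lb_nf :: 'x list \<Rightarrow> ('k::field, 'x) lb) {w. w \<noteq> []}"
  and independent_NF: "lb.independent (NF :: ('k::field, 'x) lb set)"
proof -
  let ?\<phi> = "\<lambda>x::'x. (Poly_Mapping.single (Word [x]) (1::'k), Poly_Mapping.single (Word [x]) (1::'k))"
  obtain h :: "('k, 'x) lb \<Rightarrow> _" where lin: "Vector_Spaces.linear lb_scale hemi_scale h"
    and hom: "\<And>f g. h (lb_mult f g) = hemi_mult (h f) (h g)" and gen: "\<And>x. h (lb_gen x) = ?\<phi> x"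
    using leibniz_algebra.lb_universal[OF leibniz_algebra_hemi, of ?\<phi>] by blast
  interpret h: Vector_Spaces.linear lb_scale hemi_scale h by (fact lin)
  have mono: "snd (h (lb_nf w)) = Poly_Mapping.single (Word w) 1" if "w \<in> {w. w \<noteq> []}" for w
    using that by (simp add: lb_nf_def hom_lnormed[where h = h and f = lb_mult and g = hemi_mult, OF hom] comp_def gen lnormed_hemi)
  have add: "snd (h (f + g)) = snd (h f) + snd (h g)" for f g
    by (simp add: h.add)
  have scale: "Poly_Mapping.lookup (snd (h (lb_scale c f))) m = c * Poly_Mapping.lookup (snd (h f)) m" for c f m
    by (simp add: h.scale hemi_scale_def lookup_pm_const_times)
  have inj: "inj_on Word {w :: 'x list. w \<noteq> []}"
    by (simp add: inj_on_def)
  note * = lb.independent_image_if_monomials[where F = "\<lambda>f. snd (h f)", OF add scale mono inj]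
  show "inj_on (lb_nf :: 'x list \<Rightarrow> ('k, 'x) lb) {w. w \<noteq> []}"
    using * by blast
  show "lb.independent (NF :: ('k, 'x) lb set)"
    using * by (simp add: NF_def)
qed

text \<open>
  A metabelian analogue of the hemisemidirect product: \<open>(q, p, m\<^sub>0, m\<^sub>1)\<close> consists of the strictly
  upper triangular part \<open>q\<close> and the lower right entry \<open>p\<close> of a \<open>2 \<times> 2\<close> matrix over a commutative ring
  with upper left entry \<open>0\<close>, and of a row vector \<open>(m\<^sub>0, m\<^sub>1)\<close> on which such matrices act.
\<close>
fun tri_mult :: "'a::comm_ring \<times> 'a \<times> 'a \<times> 'a \<Rightarrow> 'a \<times> 'a \<times> 'a \<times> 'a \<Rightarrow> 'a \<times> 'a \<times> 'a \<times> 'a" where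
  "tri_mult (q, p, m\<^sub>0, m\<^sub>1) (q', p', m\<^sub>0', m\<^sub>1') = (q * p' - q' * p, 0, 0, m\<^sub>0 * q' + m\<^sub>1 * p')"

fun tri_scale :: "'k \<Rightarrow> ('m::comm_monoid_add \<Rightarrow>\<^sub>0 'k::field) \<times> ('m \<Rightarrow>\<^sub>0 'k) \<times> ('m \<Rightarrow>\<^sub>0 'k) \<times> ('m \<Rightarrow>\<^sub>0 'k)
    \<Rightarrow> ('m \<Rightarrow>\<^sub>0 'k) \<times> ('m \<Rightarrow>\<^sub>0 'k) \<times> ('m \<Rightarrow>\<^sub>0 'k) \<times> ('m \<Rightarrow>\<^sub>0 'k)" where
  "tri_scale c (q, p, m\<^sub>0, m\<^sub>1) = (pm_const c * q, pm_const c * p, pm_const c * m\<^sub>0, pm_const c * m\<^sub>1)"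

lemma leibniz_algebra_tri: "leibniz_algebra tri_scale tri_mult"
  by unfold_locales (auto simp: single_add pm_const_mult algebra_simps)

text \<open>Every product has \<open>p = 0\<close> and \<open>m\<^sub>0 = 0\<close>, and any two
  such elements multiply to 0.\<close>

lemma metabelian_tri: "leibniz_algebra.metabelian tri_scale tri_mult"
  by (auto simp: leibniz_algebra.metabelian_iff[OF leibniz_algebra_tri] zero_prod_def)

text \<open>
  The first letter, the second letter and the remaining letters of a word become commuting
  variables of three different kinds.
\<close>
definition word_exponent :: "'x list \<Rightarrow> (nat \<times> 'x) multiset" where
  "word_exponent w = mset (zip (0 # 1 # replicate (length w) 2) w)"

text \<open>The first letter starts in \<open>m\<^sub>0\<close>, the second is picked up by
  \<open>m\<^sub>0 * q'\<close>, and all later ones by \<open>m\<^sub>1 * p'\<close>; hence the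
  kinds 0, 1 and 2.\<close>

definition tri_gen :: "'x \<Rightarrow> (((nat \<times> 'x) multiset \<Rightarrow>\<^sub>0 'k::field) \<times> ((nat \<times> 'x) multiset \<Rightarrow>\<^sub>0 'k) \<times>
    ((nat \<times> 'x) multiset \<Rightarrow>\<^sub>0 'k) \<times> ((nat \<times> 'x) multiset \<Rightarrow>\<^sub>0 'k))" where
  "tri_gen x = (Poly_Mapping.single {#(1, x)#} 1, Poly_Mapping.single {#(2, x)#} 1,
     Poly_Mapping.single {#(0, x)#} 1, 0)"

text \<open>The monomial of a single letter sits in \<open>m\<^sub>0\<close>, that of a longer word
  in \<open>m\<^sub>1\<close>; the sum treats both cases uniformly.\<close>

fun tri_row :: "'a::comm_ring \<times> 'a \<times> 'a \<times> 'a \<Rightarrow> 'a" where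
  "tri_row (q, p, m\<^sub>0, m\<^sub>1) = m\<^sub>0 + m\<^sub>1"

lemma word_exponent_snoc:
  assumes "length w \<ge> 2"
  shows "word_exponent (w @ [x]) = word_exponent w + {#(2, x)#}"
proof -
  obtain a b v where w: "w = a # b # v"
    using assms by (metis One_nat_def Suc_1 Suc_le_length_iff)
  \<comment> \<open>The blocks of 2s are as long as the whole words, two entries longer than their
    tails; \<open>zip\<close> cuts the surplus.\<close>
  have "zip (replicate (length v + 3) (2::nat)) (v @ [x]) = zip (replicate (length v + 2) 2) v @ [(2, x)]"
    by (simp add: zip_replicate1 del: replicate.simps replicate_Suc)
  then show ?thesis
    by (simp add: word_exponent_def w numeral_3_eq_3 numeral_2_eq_2)
qed

text \<open>The row of a product depends only on the row of the left factor and the matrix of the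
  right one, so \<open>q\<close> may stay unspecified.\<close>

lemma lnormed_tri_long:
  "\<exists>q. lnormed tri_mult (map tri_gen (a # b # w))
    = (q, 0, 0, Poly_Mapping.single (word_exponent (a # b # w)) (1 :: 'k::field))"
proof (induction w rule: rev_induct)
  case Nil
  show ?case
    by (simp add: lnormed_def tri_gen_def mult_single word_exponent_def add_mset_commute)
next
  case (snoc x w)
  have "lnormed tri_mult (map tri_gen (a # b # w @ [x]))
    = tri_mult (lnormed tri_mult (map tri_gen (a # b # w))) (tri_gen x :: _ \<times> _ \<times> _ \<times> (_ \<Rightarrow>\<^sub>0 'k))"
    using lnormed_snoc[of "map tri_gen (a # b # w)"] by simp
  then show ?case
    using snoc word_exponent_snoc[of "a # b # w" x] by (auto simp: mult_single tri_gen_def[of x])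
qed

lemma tri_row_lnormed:
  assumes "w \<noteq> []"
  shows "tri_row (lnormed tri_mult (map tri_gen w)) = Poly_Mapping.single (word_exponent w) (1 :: 'k::field)"
proof (cases w)
  case (Cons a v)
  show ?thesis
  proof (cases v)
    case Nil
    with Cons show ?thesis by (simp add: tri_gen_def word_exponent_def)
  next
    case (Cons b v')
    with \<open>w = a # v\<close> show ?thesis using lnormed_tri_long[of a b v', where 'k = 'k] by auto
  qed
qed (use assms in simp)

text \<open>Filtering by kind recovers the first letter, the second letter and the multiset of the
  rest, and a sorted list is determined by its multiset.\<close>

lemma inj_word_exponent:
  "inj_on word_exponent {w :: 'x::linorder list. w \<noteq> [] \<and> sorted (drop 2 w)}"
proof (rule inj_onI, clarify)
  define part :: "nat \<Rightarrow> (nat \<times> 'x) multiset \<Rightarrow> 'x multiset"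
    where "part i M = image_mset snd (filter_mset (\<lambda>p. fst p = i) M)" for i M
  have parts: "part 0 (word_exponent w) = mset (take 1 w)"
    "part 1 (word_exponent w) = mset (take 1 (drop 1 w))"
    "part 2 (word_exponent w) = mset (drop 2 w)" for w :: "'x list"
  proof -
    have rep: "mset (zip (replicate n (2::nat)) v) = image_mset (Pair 2) (mset (take n v))"
      for n and v :: "'x list"
      by (simp add: zip_replicate1 mset_map)
    consider "w = []" | a where "w = [a]" | a b v where "w = a # b # v"
      by (metis list.exhaust)
    then have "part 0 (word_exponent w) = mset (take 1 w) \<and>
      part 1 (word_exponent w) = mset (take 1 (drop 1 w)) \<and>
      part 2 (word_exponent w) = mset (drop 2 w)"
      by cases (simp_all add: part_def word_exponent_def rep filter_mset_image_mset
        multiset.map_comp comp_def del: replicate.simps)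
    then show "part 0 (word_exponent w) = mset (take 1 w)"
      "part 1 (word_exponent w) = mset (take 1 (drop 1 w))"
      "part 2 (word_exponent w) = mset (drop 2 w)" by blast+
  qed
  fix u v :: "'x list"
  assume eq: "word_exponent u = word_exponent v" and sorted: "sorted (drop 2 u)" "sorted (drop 2 v)"
  have "mset (take 1 u) = mset (take 1 v)" "mset (take 1 (drop 1 u)) = mset (take 1 (drop 1 v))"
    "mset (drop 2 u) = mset (drop 2 v)"
    using eq parts[of u] parts[of v] by simp_all
  moreover have "take 1 x = take 1 y" if "mset (take 1 x) = mset (take 1 y)" for x y :: "'x list"
    using that by (cases x; cases y) auto
  moreover have "drop 2 u = drop 2 v" if "mset (drop 2 u) = mset (drop 2 v)"
    using that sorted by (metis properties_for_sort)
  ultimately have "take 1 u @ take 1 (drop 1 u) @ drop 2 u = take 1 v @ take 1 (drop 1 v) @ drop 2 v"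
    by metis
  moreover have "take 1 x @ take 1 (drop 1 x) @ drop 2 x = x" for x :: "'x list"
    by (metis append_take_drop_id drop_drop one_add_one)
  ultimately show "u = v" by simp
qed

lemma inj_mlb_nf: "inj_on (mlb_nf :: 'x::linorder list \<Rightarrow> ('k::field, 'x) mlb) {w. w \<noteq> [] \<and> sorted (drop 2 w)}"
  and independent_mlb_nf:
    "mlb.independent (mlb_nf ` {w. w \<noteq> [] \<and> sorted (drop 2 w)} :: ('k::field, 'x) mlb set)"
proof -
  obtain h :: "('k, 'x) mlb \<Rightarrow> _" where lin: "Vector_Spaces.linear mlb_scale tri_scale h"
    and hom: "\<And>f g. h (mlb_mult f g) = tri_mult (h f) (h g)" and gen: "\<And>x. h (mlb_gen x) = tri_gen x"
    using leibniz_algebra.mlb_universal[OF leibniz_algebra_tri metabelian_tri, of tri_gen] by blast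
  interpret h: Vector_Spaces.linear mlb_scale tri_scale h by (fact lin)
  have mono: "tri_row (h (mlb_nf w)) = Poly_Mapping.single (word_exponent w) 1"
    if "w \<in> {w. w \<noteq> [] \<and> sorted (drop 2 w)}" for w
    using that by (simp add: mlb_nf_def hom_lnormed[where h = h and f = mlb_mult and g = tri_mult, OF hom] comp_def gen tri_row_lnormed)
  have add: "tri_row (h (f + g)) = tri_row (h f) + tri_row (h g)" for f g
    by (cases "h f"; cases "h g") (simp add: h.add)
  have scale: "Poly_Mapping.lookup (tri_row (h (mlb_scale c f))) m = c * Poly_Mapping.lookup (tri_row (h f)) m" for c f m
    by (cases "h f") (simp add: h.scale lookup_add lookup_pm_const_times distrib_left)
  note * = mlb.independent_image_if_monomials[where F = "\<lambda>f. tri_row (h f)",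
      OF add scale mono inj_word_exponent]
  show "inj_on (mlb_nf :: 'x list \<Rightarrow> ('k, 'x) mlb) {w. w \<noteq> [] \<and> sorted (drop 2 w)}"
    "mlb.independent (mlb_nf ` {w. w \<noteq> [] \<and> sorted (drop 2 w)} :: ('k, 'x) mlb set)"
    using * by blast+
qed


section \<open>Spanning by words sorted from the third letter on\<close>

lemma mlb_mult_mult_mult: "mlb_mult (mlb_mult f g) (mlb_mult h k) = (0 :: ('k::field, 'x) mlb)"
  using mlb_metabelian[where 'a = 'k and 'b = 'x] by (simp add: mlb.metabelian_iff)

text \<open>If \<open>m\<close> annihilates products, then
  \<open>0 = m (y z) = (m y) z - (m z) y\<close>, so adjacent letters after \<open>m\<close>
  commute. The hypothesis passes on to \<open>m y\<close>, which is itself a product.\<close>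

lemma mlb_foldl_insort:
  fixes m :: "('k::field, 'x::linorder) mlb"
  assumes "\<And>y z. mlb_mult m (mlb_mult y z) = 0"
  shows "foldl mlb_mult m (map mlb_gen (insort z zs)) = foldl mlb_mult m (map mlb_gen (z # zs))"
  using assms
proof (induction zs arbitrary: m)
  case (Cons y ys)
  have "foldl mlb_mult (mlb_mult m (mlb_gen y)) (map mlb_gen (insort z ys))
      = foldl mlb_mult (mlb_mult (mlb_mult m (mlb_gen y)) (mlb_gen z)) (map mlb_gen ys)"
    using Cons.IH[of "mlb_mult m (mlb_gen y)"] by (simp add: mlb_mult_mult_mult)
  moreover have "mlb_mult (mlb_mult m (mlb_gen y)) (mlb_gen z) = mlb_mult (mlb_mult m (mlb_gen z)) (mlb_gen y)"
    using Cons.prems[of "mlb_gen y" "mlb_gen z"] by (simp add: mlb.leibniz)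
  ultimately show ?case by simp
qed simp

lemma mlb_foldl_sort:
  fixes m :: "('k::field, 'x::linorder) mlb"
  assumes "\<And>y z. mlb_mult m (mlb_mult y z) = 0"
  shows "foldl mlb_mult m (map mlb_gen (sort zs)) = foldl mlb_mult m (map mlb_gen zs)"
  using assms
proof (induction zs arbitrary: m)
  case (Cons y ys)
  then show ?case
    by (simp add: mlb_foldl_insort mlb_mult_mult_mult)
qed simp

lemma mlb_nf_sort: "mlb_nf (a # b # w) = mlb_nf (a # b # sort w)"
  by (simp add: mlb_nf_def lnormed_def mlb_foldl_sort mlb_mult_mult_mult)

lemma span_mlb_nf_sorted:
  "mlb.span {mlb_nf w :: ('k::field, 'x::linorder) mlb | w. w \<noteq> [] \<and> sorted (drop 2 w)} = UNIV"
  (is "mlb.span ?B = _")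
proof -
  have "{mlb_nf w :: ('k, 'x) mlb | w. w \<noteq> []} \<subseteq> ?B"
  proof safe
    fix w :: "'x list" assume "w \<noteq> []"
    then consider a where "w = [a]" | a b v where "w = a # b # v"
      by (metis list.exhaust)
    then show "\<exists>v. mlb_nf w = (mlb_nf v :: ('k, 'x) mlb) \<and> v \<noteq> [] \<and> sorted (drop 2 v)"
    proof cases
      case (2 a b v)
      then show ?thesis by (intro exI[of _ "a # b # sort v"]) (simp flip: mlb_nf_sort)
    qed auto
  qed
  then show ?thesis
    using mlb.span_mono span_mlb_nf[where 'a = 'k and 'b = 'x] by blast
qed


section \<open>The Groebner--Shirshov basis\<close>

lemma word_less_trans: "word_less u v \<Longrightarrow> word_less v w \<Longrightarrow> word_less u w"
  unfolding word_less_def by (rule lenlex_trans) (auto intro: transI)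

lemma word_less_irrefl: "\<not> word_less u u"
  by (simp add: word_less_def lenlex_irreflexive)

lemma wf_word_less: "wf {(u, v). word_less u v}"
  unfolding word_less_def using wf_lenlex[OF wf] by simp

lemma word_less_swap: "b < a \<Longrightarrow> word_less (u @ b # a # v) (u @ a # b # v)"
  by (simp add: word_less_def lenlex_append2 irrefl_def Cons_lenlex_iff)

lemma lb_nf_snoc:
  "w \<noteq> [] \<Longrightarrow> (lb_nf (w @ [x]) :: ('k::field, 'x) lb) = lb_mult (lb_nf w) (lb_gen x)"
  by (simp add: lb_nf_def lnormed_snoc)

lemma lb_coeff_nf_diff:
  assumes "u \<noteq> []" "v \<noteq> []" "w \<noteq> []"
  shows "lb_coeff (lb_nf u - lb_nf v :: ('k::field, 'x) lb) w
    = (if w = u then 1 else 0) - (if w = v then 1 else 0)"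
proof -
  have *: "lb.representation NF (lb_nf y) (lb_nf w) = (if w = y then 1 else 0 :: 'k)" if "y \<noteq> []" for y :: "'x list"
    using that assms(3) inj_onD[OF inj_lb_nf[where 'k = 'k and 'x = 'x], of w y]
    by (subst lb.representation_basis[OF independent_NF]) (auto simp: NF_def)
  show ?thesis
    unfolding lb_coeff_def
    by (subst lb.representation_diff[OF independent_NF]) (simp_all add: span_NF * assms)
qed

lemma lead_nf_diff:
  fixes u v :: "'x::wellorder list"
  assumes "u \<noteq> []" "v \<noteq> []" "word_less v u"
  shows "lead (lb_nf u - lb_nf v :: ('k::field, 'x) lb) = u"
  unfolding lead_def
proof (rule the_equality)
  have "u \<noteq> v"
    using assms word_less_irrefl by blast
  with assms show "u \<noteq> [] \<and> lb_coeff (lb_nf u - lb_nf v :: ('k, 'x) lb) u \<noteq> 0 \<and>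
      (\<forall>w. w \<noteq> [] \<and> lb_coeff (lb_nf u - lb_nf v :: ('k, 'x) lb) w \<noteq> 0 \<longrightarrow> w = u \<or> word_less w u)"
    by (auto simp: lb_coeff_nf_diff split: if_splits)
  fix w
  assume w: "w \<noteq> [] \<and> lb_coeff (lb_nf u - lb_nf v :: ('k, 'x) lb) w \<noteq> 0 \<and>
      (\<forall>y. y \<noteq> [] \<and> lb_coeff (lb_nf u - lb_nf v :: ('k, 'x) lb) y \<noteq> 0 \<longrightarrow> y = w \<or> word_less y w)"
  \<comment> \<open>Only \<open>u\<close> and \<open>v\<close> have non-zero coefficients, and
    \<open>w = v\<close> would put \<open>u\<close> at or below \<open>v\<close>.\<close>
  then have "u = w \<or> word_less u w" and "w = u \<or> w = v"
    using assms \<open>u \<noteq> v\<close> by (auto simp: lb_coeff_nf_diff split: if_splits)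
  then show "w = u"
    using assms(3) word_less_trans word_less_irrefl by blast
qed

lemma monic_nf_diff:
  assumes "u \<noteq> []" "v \<noteq> []" "word_less v u"
  shows "monic (lb_nf u - lb_nf v :: ('k::field, 'x::wellorder) lb)"
proof -
  have "u \<noteq> v"
    using assms word_less_irrefl by blast
  then have "lb_coeff (lb_nf u - lb_nf v :: ('k, 'x) lb) u = 1"
    using assms by (simp add: lb_coeff_nf_diff)
  moreover have "lb_coeff (0 :: ('k, 'x) lb) u = 0"
    by (simp add: lb_coeff_def lb.representation_zero)
  ultimately show ?thesis
    unfolding monic_def lead_nf_diff[OF assms] by force
qed

text \<open>Each element is \<open>[cs]_L (a b)\<close> by the Leibniz identity; as
  \<open>cs\<close> has at least two letters, it is a product of two products.\<close>

definition metab_swaps :: "('k::field, 'x::wellorder) lb set" where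
  "metab_swaps = {lb_nf (cs @ [a, b]) - lb_nf (cs @ [b, a]) | cs a b. length cs \<ge> 2 \<and> b < a}"

lemma metab_swapsE:
  assumes "f \<in> metab_swaps"
  obtains cs a b where "f = lb_nf (cs @ [a, b]) - lb_nf (cs @ [b, a])" "length cs \<ge> 2" "b < a"
  using assms unfolding metab_swaps_def by blast

lemma lb_foldl_diff:
  "foldl lb_mult (f - g) xs = foldl lb_mult f xs - foldl lb_mult g xs"
  by (induction xs arbitrary: f g) (simp_all add: lb.mult_diff_left)

lemma lnormed_swap:
  "lnormed lb_mult ((lb_nf (cs @ [a, b]) - lb_nf (cs @ [b, a])) # map lb_gen v)
    = (lb_nf (cs @ a # b # v) - lb_nf (cs @ b # a # v) :: ('k::field, 'x) lb)"
proof -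
  have "(lb_nf (cs @ c # d # v) :: ('k, 'x) lb) = foldl lb_mult (lb_nf (cs @ [c, d])) (map lb_gen v)" for c d
    using lnormed_append[of "map lb_gen (cs @ [c, d])" lb_mult "map lb_gen v"] by (simp add: lb_nf_def)
  then show ?thesis
    by (simp add: lnormed_def lb_foldl_diff)
qed

text \<open>Leading words in \<open>metab_swaps\<close> have length at least 4, so only normal
  polynomials of the first kind arise: right multiples by letters.\<close>

lemma normal_poly_metab_swaps_iff:
  "(\<exists>s\<in>metab_swaps. normal_poly s (h :: ('k::field, 'x::wellorder) lb)) \<longleftrightarrow>
    (\<exists>cs a b v. length cs \<ge> 2 \<and> b < a \<and> h = lb_nf (cs @ a # b # v) - lb_nf (cs @ b # a # v))"
proof safe
  fix s :: "('k, 'x) lb" assume "s \<in> metab_swaps" and h: "normal_poly s h"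
  then obtain cs a b where s: "s = lb_nf (cs @ [a, b]) - lb_nf (cs @ [b, a])" "length cs \<ge> 2" "b < a"
    by (auto elim: metab_swapsE)
  then have "lead s = cs @ [a, b]"
    using lead_nf_diff[of "cs @ [a, b]" "cs @ [b, a]"] word_less_swap[of b a cs "[]"] by simp
  with h obtain v where "h = lnormed lb_mult (s # map lb_gen v)"
    by (auto elim: normal_poly.cases)
  with s show "\<exists>cs a b v. length cs \<ge> 2 \<and> b < a \<and> h = lb_nf (cs @ a # b # v) - lb_nf (cs @ b # a # v)"
    by (metis lnormed_swap)
next
  fix cs v :: "'x list" and a b :: 'x assume "2 \<le> length cs" "b < a"
  then show "\<exists>s\<in>metab_swaps. normal_poly s (lb_nf (cs @ a # b # v) - lb_nf (cs @ b # a # v) :: ('k, 'x) lb)"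
    using normal_poly.intros(1)[of "lb_nf (cs @ [a, b]) - lb_nf (cs @ [b, a]) :: ('k, 'x) lb" v]
    unfolding lnormed_swap metab_swaps_def by blast
qed

lemma lead_swap:
  "b < a \<Longrightarrow> lead (lb_nf (cs @ a # b # v) - lb_nf (cs @ b # a # v)) = cs @ a # b # v"
  by (rule lead_nf_diff) (simp_all add: word_less_swap)

section \<open>Rewriting to sorted words and compositions of inclusion\<close>

lemma unsorted_descent:
  assumes "\<not> sorted xs"
  obtains u a b v where "xs = u @ a # b # v" "b < a"
proof -
  obtain i where i: "Suc i < length xs" "xs ! Suc i < xs ! i"
    using assms by (auto simp: sorted_iff_nth_Suc not_le)
  then have "xs = take i xs @ xs ! i # xs ! Suc i # drop (Suc (Suc i)) xs"
    by (metis Cons_nth_drop_Suc Suc_lessD append_take_drop_id)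
  with i that show thesis by blast
qed

text \<open>Swapping a descent after the second letter gives a smaller word with the same sorted
  form. The difference is a normal polynomial with leading word \<open>w\<close>, hence allowed
  below \<open>\<mu>\<close>; well-founded induction does the rest.\<close>

lemma nf_sort_trivial_below:
  fixes w :: "'x::wellorder list"
  assumes "word_less w \<mu>"
  shows "trivial_below metab_swaps \<mu> (lb_nf w - lb_nf (take 2 w @ sort (drop 2 w)) :: ('k::field, 'x) lb)"
  using assms
proof (induction w rule: wf_induct_rule[OF wf_word_less])
  case (1 w)
  show ?case
  proof (cases "sorted (drop 2 w)")
    case True
    then have "take 2 w @ sort (drop 2 w) = w"
      by (simp add: sorted_sort_id)
    then show ?thesis
      by (simp add: trivial_below_def lb.span_zero)
  next
    case False
    then obtain u a b v where d: "drop 2 w = u @ a # b # v" and ba: "b < a"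
      by (rule unsorted_descent)
    \<comment> \<open>The two fixed letters are put in front, so that the swap has the prefix of
      length at least 2 required by \<open>metab_swaps\<close>.\<close>
    define cs where "cs = take 2 w @ u"
    have w: "w = cs @ a # b # v"
      by (metis append.assoc append_take_drop_id cs_def d)
    have l2: "length (take 2 w) = 2"
      using d by (cases w; cases "tl w") auto
    then have cs: "length cs \<ge> 2"
      by (simp add: cs_def)
    let ?w = "cs @ b # a # v"
    have less: "word_less ?w w"
      using ba by (simp add: w word_less_swap)
    have tk: "take 2 ?w = take 2 w" and dr: "drop 2 ?w = u @ b # a # v"
      using l2 by (simp_all add: cs_def)
    have "sort (drop 2 ?w) = sort (drop 2 w)"
      unfolding dr d by (rule properties_for_sort) simp_all
    then have IH: "trivial_below metab_swaps \<mu>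
        (lb_nf ?w - lb_nf (take 2 w @ sort (drop 2 w)) :: ('k, 'x) lb)"
      using 1(1)[of ?w] less word_less_trans[OF less 1(2)] by (simp only: tk mem_Collect_eq case_prod_conv)
    let ?h = "lb_nf (cs @ a # b # v) - lb_nf ?w :: ('k, 'x) lb"
    have "\<exists>s\<in>metab_swaps. normal_poly s ?h"
      using cs ba normal_poly_metab_swaps_iff by blast
    moreover have "word_less (lead ?h) \<mu>"
      using lead_swap[OF ba] 1(2) w by metis
    ultimately have "trivial_below metab_swaps \<mu> ?h"
      unfolding trivial_below_def by (intro lb.span_base) blast
    with IH have "trivial_below metab_swaps \<mu> (?h + (lb_nf ?w - lb_nf (take 2 w @ sort (drop 2 w))))"
      unfolding trivial_below_def by (intro lb.span_add)
    then show ?thesis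
      using w by simp
  qed
qed

lemma nf_diff_trivial_below:
  fixes u v :: "'x::wellorder list"
  assumes "word_less u \<mu>" "word_less v \<mu>" "take 2 u = take 2 v" "mset (drop 2 u) = mset (drop 2 v)"
  shows "trivial_below metab_swaps \<mu> (lb_nf u - lb_nf v :: ('k::field, 'x) lb)"
proof -
  have sort: "sort (drop 2 u) = sort (drop 2 v)"
    using assms(4) by (intro properties_for_sort) simp_all
  let ?n = "lb_nf (take 2 v @ sort (drop 2 v)) :: ('k, 'x) lb"
  have "trivial_below metab_swaps \<mu> (lb_nf u - ?n)" "trivial_below metab_swaps \<mu> (lb_nf v - ?n)"
    using nf_sort_trivial_below[OF assms(1)] nf_sort_trivial_below[OF assms(2)]
    by (simp_all only: sort assms(3))
  then have "trivial_below metab_swaps \<mu> ((lb_nf u - ?n) - (lb_nf v - ?n))"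
    unfolding trivial_below_def by (rule lb.span_diff)
  then show ?thesis by simp
qed

text \<open>The equal leading words cancel in \<open>f - h\<close>. The two remaining words arise
  from that common word by swaps after the second letter, so they share their sorted form and lie
  below it.\<close>

lemma metab_swaps_inclusion_trivial:
  assumes "f \<in> metab_swaps" "g \<in> metab_swaps" "normal_poly g h" "lead f = lead h"
  shows "trivial_below metab_swaps (lead f) (f - h)"
proof -
  obtain cs a b where f: "f = lb_nf (cs @ a # b # []) - lb_nf (cs @ b # a # [])" "length cs \<ge> 2" "b < a"
    using assms(1) by (rule metab_swapsE)
  obtain cs' a' b' v where h: "h = lb_nf (cs' @ a' # b' # v) - lb_nf (cs' @ b' # a' # v)"
    "length cs' \<ge> 2" "b' < a'"
    using assms(2,3) normal_poly_metab_swaps_iff by blast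
  have lead: "lead f = cs @ a # b # []" "lead h = cs' @ a' # b' # v"
    unfolding f(1) h(1) using f(3) h(3) by (simp_all only: lead_swap)
  have eq: "cs @ a # b # [] = cs' @ a' # b' # v"
    using lead assms(4) by simp
  have swap: "take 2 (ds @ d # c # w) = take 2 (ds @ c # d # w)"
    "mset (drop 2 (ds @ d # c # w)) = mset (drop 2 (ds @ c # d # w))"
    if "length ds \<ge> 2" for ds w and c d :: 'b
    using that by simp_all
  have "trivial_below metab_swaps (lead f) (lb_nf (cs' @ b' # a' # v) - lb_nf (cs @ b # a # []) :: ('a, 'b) lb)"
  proof (rule nf_diff_trivial_below)
    show "word_less (cs' @ b' # a' # v) (lead f)" "word_less (cs @ b # a # []) (lead f)"
      using word_less_swap[OF h(3), of cs' v] word_less_swap[OF f(3), of cs "[]"] lead eq by simp_all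
    show "take 2 (cs' @ b' # a' # v) = take 2 (cs @ b # a # [])"
      "mset (drop 2 (cs' @ b' # a' # v)) = mset (drop 2 (cs @ b # a # []))"
      using swap[OF h(2)] swap[OF f(2)] eq by metis+
  qed
  moreover have "f - h = lb_nf (cs' @ b' # a' # v) - lb_nf (cs @ b # a # [])"
    unfolding f(1) h(1) eq by simp
  ultimately show ?thesis by simp
qed

section \<open>Left multiples of the relations\<close>

lemma nf_mult_commutator_trivial:
  assumes "length w \<ge> 2" "length w + 2 \<le> n"
  shows "trivial_deg metab_swaps n
    (lb_mult (lb_nf w) (lb_mult (lb_gen a) (lb_gen b)) :: ('k::field, 'x::wellorder) lb)"
proof -
  have swap: "trivial_deg metab_swaps n (lb_nf (w @ d # c # []) - lb_nf (w @ c # d # []) :: ('k, 'x) lb)"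
    if "c < d" for c d
  proof -
    let ?h = "lb_nf (w @ d # c # []) - lb_nf (w @ c # d # []) :: ('k, 'x) lb"
    have "\<exists>s\<in>metab_swaps. normal_poly s ?h"
      using assms(1) that normal_poly_metab_swaps_iff by blast
    moreover have "lead ?h = w @ d # c # []"
      using that by (rule lead_swap)
    ultimately show ?thesis
      unfolding trivial_deg_def using assms(2) by (intro lb.span_base) auto
  qed
  have "w \<noteq> []"
    using assms(1) by auto
  then have "lb_nf (w @ c # d # []) = (lb_mult (lb_mult (lb_nf w) (lb_gen c)) (lb_gen d) :: ('k, 'x) lb)" for c d
    using lb_nf_snoc[of "w @ [c]" d, where 'k = 'k] by (simp add: lb_nf_snoc)
  then have eq: "lb_mult (lb_nf w) (lb_mult (lb_gen a) (lb_gen b))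
      = (lb_nf (w @ a # b # []) - lb_nf (w @ b # a # []) :: ('k, 'x) lb)"
    by (simp only: lb.leibniz)
  consider "a < b" | "a = b" | "b < a"
    by fastforce
  then show ?thesis
  proof cases
    case 1
    from swap[OF this] show ?thesis
      unfolding eq trivial_deg_def using lb.span_neg by fastforce
  next
    case 2
    then show ?thesis unfolding eq by (simp add: trivial_deg_def lb.span_zero)
  next
    case 3
    from swap[OF this] show ?thesis by (simp only: eq)
  qed
qed

text \<open>Right multiplication by \<open>x\<close> appends \<open>x\<close> to the tail
  \<open>v\<close> of a normal polynomial, which gives a normal polynomial of degree one
  higher.\<close>

lemma trivial_deg_mult_gen:
  assumes "trivial_deg metab_swaps n f"
  shows "trivial_deg metab_swaps (Suc n) (lb_mult f (lb_gen x) :: ('k::field, 'x::wellorder) lb)"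
  unfolding trivial_deg_def
proof (rule lb.span_mult_left[OF assms[unfolded trivial_deg_def]], clarify)
  fix h s :: "('k, 'x) lb"
  assume "s \<in> metab_swaps" "normal_poly s h" and len: "length (lead h) \<le> n"
  then obtain cs a b v where h: "h = lb_nf (cs @ a # b # v) - lb_nf (cs @ b # a # v)"
    "length cs \<ge> 2" "b < a"
    using normal_poly_metab_swaps_iff by blast
  have "lead h = cs @ a # b # v"
    unfolding h(1) using h(3) by (rule lead_swap)
  with len have n: "length (cs @ a # b # v) \<le> n" by simp
  let ?h = "lb_nf (cs @ a # b # v @ [x]) - lb_nf (cs @ b # a # v @ [x]) :: ('k, 'x) lb"
  have "lb_mult h (lb_gen x) = ?h"
    using lb_nf_snoc[of "cs @ a # b # v" x, where 'k = 'k] lb_nf_snoc[of "cs @ b # a # v" x, where 'k = 'k]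
    by (simp add: h(1) lb.mult_diff_left)
  moreover have "\<exists>s\<in>metab_swaps. normal_poly s ?h"
    using h normal_poly_metab_swaps_iff by blast
  moreover have "lead ?h = cs @ a # b # v @ [x]"
    using h(3) by (rule lead_swap)
  ultimately show "lb_mult h (lb_gen x)
      \<in> lb.span {h. \<exists>s\<in>metab_swaps. normal_poly s h \<and> length (lead h) \<le> Suc n}"
    using n by (intro lb.span_base) auto
qed

text \<open>This is the metabelian law modulo \<open>metab_swaps\<close>, with control of the
  degree. Induction on \<open>c\<close> by the Leibniz identity ends at \<open>c = [y, x]\<close>, a
  commutator of letters.\<close>

lemma nf_mult_nf_trivial:
  assumes "length c \<ge> 2" "length w \<ge> 2"
  shows "trivial_deg metab_swaps (length w + length c)
    (lb_mult (lb_nf w) (lb_nf c) :: ('k::field, 'x::wellorder) lb)"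
  using assms
proof (induction c arbitrary: w rule: rev_induct)
  case (snoc x c)
  then have "c \<noteq> []" "w \<noteq> []" by auto
  show ?case
  proof (cases "length c \<ge> 2")
    case False
    with snoc.prems obtain y where c: "c = [y]"
      by (cases c; cases "tl c") auto
    have "lb_nf (c @ [x]) = (lb_mult (lb_gen y) (lb_gen x) :: ('k, 'x) lb)"
      by (simp add: c lb_nf_def lnormed_def)
    then show ?thesis
      using snoc.prems(2) nf_mult_commutator_trivial[of w _ y x, where 'k = 'k] by (simp add: c)
  next
    case True
    have "trivial_deg metab_swaps (length w + length (c @ [x]))
        (lb_mult (lb_mult (lb_nf w) (lb_nf c)) (lb_gen x) :: ('k, 'x) lb)"
      using trivial_deg_mult_gen[OF snoc.IH[OF True snoc.prems(2)]] by simp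
    moreover have "trivial_deg metab_swaps (length w + length (c @ [x]))
        (lb_mult (lb_mult (lb_nf w) (lb_gen x)) (lb_nf c) :: ('k, 'x) lb)"
      using snoc.IH[OF True, of "w @ [x]"] snoc.prems(2) \<open>w \<noteq> []\<close> by (simp add: lb_nf_snoc)
    ultimately show ?thesis
      using \<open>c \<noteq> []\<close> by (simp add: lb_nf_snoc lb.leibniz trivial_deg_def lb.span_diff)
  qed
qed simp

lemma nf_mult_metab_swap_trivial:
  assumes "f \<in> metab_swaps" "u \<noteq> []"
  shows "trivial_deg metab_swaps (length u + length (lead f)) (lb_mult (lb_nf u) f :: ('k::field, 'x::wellorder) lb)"
proof -
  obtain cs a b where f: "f = lb_nf (cs @ a # b # []) - lb_nf (cs @ b # a # [])"
    and cs: "length cs \<ge> 2" and ba: "b < a"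
    using assms(1) by (rule metab_swapsE)
  let ?n = "length u + length (lead f)" and ?ab = "lb_mult (lb_gen a) (lb_gen b) :: ('k, 'x) lb"
  have n: "?n = length u + length cs + 2"
    unfolding f lead_swap[OF ba] by simp
  have nf: "lb_mult (lb_nf w) ?ab = lb_nf (w @ a # b # []) - lb_nf (w @ b # a # [])" if "w \<noteq> []" for w
    using that lb_nf_snoc[of "w @ [a]" b, where 'k = 'k] lb_nf_snoc[of "w @ [b]" a, where 'k = 'k]
    by (simp add: lb.leibniz lb_nf_snoc)
  have "cs \<noteq> []"
    using cs by auto
  then have "f = lb_mult (lb_nf cs) ?ab"
    unfolding f by (rule nf[symmetric])
  then have eq: "lb_mult (lb_nf u) f = lb_mult (lb_mult (lb_nf u) (lb_nf cs)) ?ab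
      - lb_mult (lb_mult (lb_nf u) ?ab) (lb_nf cs)"
    by (simp only: lb.leibniz[of "lb_nf u" "lb_nf cs"])
  \<comment> \<open>Homogeneity matters here: each word in the expansion has length exactly
    \<open>length u + length cs\<close>, so two more letters give degree \<open>?n\<close>.\<close>
  have "lb_mult (lb_nf u) (lb_nf cs)
      \<in> lb.span {lb_nf w :: ('k, 'x) lb | w. length w = length u + length cs}"
    using lb.mult_lnormed_in_span[OF \<open>cs \<noteq> []\<close> \<open>u \<noteq> []\<close>] by (simp add: lb_nf_def)
  then have "trivial_deg metab_swaps ?n (lb_mult (lb_mult (lb_nf u) (lb_nf cs)) ?ab)"
    unfolding trivial_deg_def
  proof (rule lb.span_mult_left)
    fix g assume "g \<in> {lb_nf w :: ('k, 'x) lb | w. length w = length u + length cs}"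
    then obtain w where "g = lb_nf w" "length w = length u + length cs" by blast
    then show "lb_mult g ?ab \<in> lb.span {h. \<exists>s\<in>metab_swaps. normal_poly s h \<and> length (lead h) \<le> ?n}"
      using nf_mult_commutator_trivial[of w ?n a b, where 'k = 'k] cs n by (simp add: trivial_deg_def)
  qed
  moreover have "trivial_deg metab_swaps ?n (lb_mult (lb_mult (lb_nf u) ?ab) (lb_nf cs))"
  proof -
    \<comment> \<open>Even for a single letter \<open>u\<close>, multiplying by \<open>?ab\<close>
      gives words of length at least 2, as the metabelian law requires.\<close>
    have "trivial_deg metab_swaps ?n (lb_mult (lb_nf (u @ [c, d])) (lb_nf cs) :: ('k, 'x) lb)" for c d
      using nf_mult_nf_trivial[OF cs, of "u @ [c, d]"] n by simp
    then show ?thesis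
      by (simp add: nf[OF assms(2)] lb.mult_diff_left trivial_deg_def lb.span_diff)
  qed
  ultimately show ?thesis
    unfolding eq trivial_deg_def by (rule lb.span_diff)
qed

lemma monic_metab_swaps:
  assumes "f \<in> metab_swaps"
  shows "monic f"
proof -
  obtain cs a b where f: "f = lb_nf (cs @ [a, b]) - lb_nf (cs @ [b, a])" "b < a"
    using assms by (rule metab_swapsE)
  show ?thesis
    unfolding f(1) by (rule monic_nf_diff[OF _ _ word_less_swap[OF f(2)]]) simp_all
qed

lemma GS_basis_metab_swaps: "GS_basis metab_swaps"
  unfolding GS_basis_def
  using monic_metab_swaps metab_swaps_inclusion_trivial nf_mult_metab_swap_trivial by blast

theorem corollary5p6:
  shows "GS_basis {lb_nf (cs @ [a\<^sub>1, a\<^sub>2]) - lb_nf (cs @ [a\<^sub>2, a\<^sub>1]) :: ('k::field, 'x::wellorder) lb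
           | cs a\<^sub>1 a\<^sub>2. length cs \<ge> 2 \<and> a\<^sub>2 < a\<^sub>1} \<and>
         inj_on (mlb_nf :: 'x list \<Rightarrow> ('k, 'x) mlb) {w. w \<noteq> [] \<and> sorted (drop 2 w)} \<and>
         mlb.independent {mlb_nf w :: ('k, 'x) mlb | w. w \<noteq> [] \<and> sorted (drop 2 w)} \<and>
         mlb.span {mlb_nf w :: ('k, 'x) mlb | w. w \<noteq> [] \<and> sorted (drop 2 w)} = UNIV"
  using GS_basis_metab_swaps inj_mlb_nf independent_mlb_nf span_mlb_nf_sorted
  unfolding metab_swaps_def image_Collect by (intro conjI)

end
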